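(* Let $M=2^{2\lambda}$ with $\lambda$ a positive integer, and let $\mathcal{S}$ be the square $M$-QAM signal set. The number $N_{M\text{-}QAM}$ of singular fade states of $\mathcal{S}$ is $$N_{M\text{-}QAM}=4+8\,\phi(\Delta\mathcal{S}^+),$$ where $\phi(\Delta\mathcal{S}^+)$ is the number of unordered pairs of distinct elements of $\Delta\mathcal{S}^+$ that are relatively prime in $\mathbb{Z}[j]$.
   Context: A fade state is a nonzero complex number $z=\gamma e^{j\theta}$ ($\gamma>0$, $-\pi\le\theta<\pi$, $j=\sqrt{-1}$). For a finite signal set $\mathcal{S}\subset\mathbb{C}$ used at both end nodes, a fade state $z$ is a singular fade state if $\{x+z y : x,y\in\mathcal{S}\}$ has fewer than $|\mathcal{S}|^2$ elements. The square $M$-QAM signal set is $\mathcal{S}=\{a+jb : a,b\in P\}$ with $P=\{-(\sqrt M-1)+2n : n=0,1,\dots,\sqrt M-1\}$. Its difference constellation is $\{x-x' : x,x'\in\mathcal{S}\}$; after scaling by $\tfrac12$ this consists of Gaussian integers, and $\Delta\mathcal{S}^+$ denotes the set of elements $\alpha$ of the scaled difference constellation with $\mathrm{Re}(\alpha)>0$ and $\mathrm{Im}(\alpha)\ge 0$, i.e. $\Delta\mathcal{S}^+=\{a+jb : a,b\in\mathbb{Z},\ 1\le a\le\sqrt M-1,\ 0\le b\le \sqrt M-1\}$. Two elements $\alpha,\beta\in\mathbb{Z}[j]=\{a+bj: a,b\in\mathbb{Z}\}$ are relatively prime if their only common divisors in $\mathbb{Z}[j]$ are the units $\pm1,\pm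 j$. *)

theory Defs
  imports Complex_Main
begin

definition fade_state :: "complex \<Rightarrow> bool" where
  "fade_state z \<longleftrightarrow> z \<noteq> 0"

definition singular_fade_state :: "complex set \<Rightarrow> complex \<Rightarrow> bool" where
  "singular_fade_state S z \<longleftrightarrow>
     fade_state z \<and> card {x + z * y | x y. x \<in> S \<and> y \<in> S} < (card S)\<^sup>2"

definition pam_points :: "nat \<Rightarrow> real set" where
  "pam_points M = {- (sqrt (real M) - 1) + 2 * real n | n :: nat. real n \<le> sqrt (real M) - 1}"

definition qam :: "nat \<Rightarrow> complex set" where
  "qam M = {Complex a b | a b. a \<in> pam_points M \<and> b \<in> pam_points M}"

definition scaled_differences :: "complex set \<Rightarrow> complex set" where
  "scaled_differences S = {(x - x') / 2 | x x'. x \<in> S \<and> x' \<in> S}"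

definition delta_plus :: "complex set \<Rightarrow> complex set" where
  "delta_plus S = {\<alpha> \<in> scaled_differences S. Re \<alpha> > 0 \<and> Im \<alpha> \<ge> 0}"

definition gauss_ints :: "complex set" where
  "gauss_ints = {Complex (of_int a) (of_int b) | a b :: int. True}"

text \<open>Divisibility must be taken in the ring of Gaussian integers: the library relation
  \<open>dvd\<close> at type \<^typ>\<open>complex\<close> is divisibility in a field.\<close>

definition gauss_dvd :: "complex \<Rightarrow> complex \<Rightarrow> bool" where
  "gauss_dvd \<delta> \<alpha> \<longleftrightarrow> \<delta> \<in> gauss_ints \<and> (\<exists>\<gamma>\<in>gauss_ints. \<alpha> = \<delta> * \<gamma>)"

definition gauss_coprime :: "complex \<Rightarrow> complex \<Rightarrow> bool" where
  "gauss_coprime \<alpha> \<beta> \<longleftrightarrow>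
     (\<forall>\<delta>. gauss_dvd \<delta> \<alpha> \<and> gauss_dvd \<delta> \<beta> \<longrightarrow> \<delta> \<in> {1, -1, \<i>, -\<i>})"

definition num_coprime_pairs :: "complex set \<Rightarrow> nat" where
  "num_coprime_pairs A =
     card {{\<alpha>, \<beta>} | \<alpha> \<beta>. \<alpha> \<in> A \<and> \<beta> \<in> A \<and> \<alpha> \<noteq> \<beta> \<and> gauss_coprime \<alpha> \<beta>}"

lemma pam_points_square:
  "pam_points (m\<^sup>2) = (\<lambda>n. 2 * real n - (real m - 1)) ` {..<m}"
proof -
  have "real n \<le> real m - 1 \<longleftrightarrow> n < m" for n
    by linarith
  then show ?thesis
    by (auto simp: pam_points_def image_iff)
qed

lemma delta_plus_qam:
  assumes "m > 0"
  shows "delta_plus (qam (m\<^sup>2)) =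
    {Complex (of_int a) (of_int b) | a b :: int.
       1 \<le> a \<and> a \<le> int m - 1 \<and> 0 \<le> b \<and> b \<le> int m - 1}" (is "?L = ?R")
proof
  show "?L \<subseteq> ?R"
  proof
    fix z assume "z \<in> ?L"
    then obtain p q r s where "p < m" "q < m" "r < m" "s < m"
      and z: "z = (Complex (2 * real p - (real m - 1)) (2 * real q - (real m - 1)) -
           Complex (2 * real r - (real m - 1)) (2 * real s - (real m - 1))) / 2"
      and pos: "Re z > 0" "Im z \<ge> 0"
      by (auto simp: delta_plus_def scaled_differences_def qam_def pam_points_square)
    have "z = Complex (of_int (int p - int r)) (of_int (int q - int s))"
      by (simp add: z complex_eq_iff)
    moreover from this pos have "r < p" "s \<le> q"
      by auto
    ultimately show "z \<in> ?R"
      using \<open>p < m\<close> \<open>q < m\<close>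
      by (intro CollectI exI[of _ "int p - int r"] exI[of _ "int q - int s"]) auto
  qed
next
  show "?R \<subseteq> ?L"
  proof
    fix z assume "z \<in> ?R"
    then obtain a b where z: "z = Complex (of_int a) (of_int b)"
      and ab: "1 \<le> a" "a \<le> int m - 1" "0 \<le> b" "b \<le> int m - 1"
      by blast
    define f where "f n = 2 * real n - (real m - 1)" for n
    have f: "f n \<in> pam_points (m\<^sup>2)" if "n < m" for n
      using that by (auto simp: pam_points_square f_def)
    have "z = (Complex (f (nat a)) (f (nat b)) - Complex (f 0) (f 0)) / 2"
      using ab by (simp add: z f_def complex_eq_iff)
    moreover have "Complex (f (nat a)) (f (nat b)) \<in> qam (m\<^sup>2)" "Complex (f 0) (f 0) \<in> qam (m\<^sup>2)"
      using ab assms by (auto simp: qam_def intro!: f)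
    ultimately show "z \<in> ?L"
      using ab unfolding delta_plus_def scaled_differences_def by (auto simp: z)
  qed
qed

end

theory Submission
  imports Defs
begin

text \<open>
  The singular fade states are the ratios of nonzero differences. For such a ratio \<open>z\<close> the Gaussian
  integers \<open>\<beta>\<close> with \<open>z * \<beta>\<close> a Gaussian integer form an ideal; a generator \<open>\<beta>\<close> of it gives a
  coprime fraction \<open>z * \<beta> / \<beta>\<close> representing \<open>z\<close>, unique up to units. Cancelling a nonunit
  divides absolute values by at least \<open>sqrt 2\<close>, which maps the circumscribed disc of the square of
  differences onto the inscribed one, so numerator and denominator stay in the square. Normalising
  both to the quadrant \<open>Re > 0\<close>, \<open>Im \<ge> 0\<close> yields a bijection between the singular fade states and
  the triples of a unit and an ordered coprime pair. The only coprime pair on the diagonal is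
  \<open>(1, 1)\<close>, and each unordered pair accounts for two of the others.
\<close>

section \<open>Gaussian integers\<close>

lemma gauss_ints_iff: "z \<in> gauss_ints \<longleftrightarrow> Re z \<in> \<int> \<and> Im z \<in> \<int>"
  by (force simp: gauss_ints_def complex_eq_iff Ints_def)

lemma gauss_ints_diff: "z \<in> gauss_ints \<Longrightarrow> w \<in> gauss_ints \<Longrightarrow> z - w \<in> gauss_ints"
  by (simp add: gauss_ints_iff)

lemma gauss_ints_mult: "z \<in> gauss_ints \<Longrightarrow> w \<in> gauss_ints \<Longrightarrow> z * w \<in> gauss_ints"
  by (simp add: gauss_ints_iff)

lemma gauss_ints_cmod_square:
  assumes "z \<in> gauss_ints"
  obtains n :: nat where "(cmod z)\<^sup>2 = real n"
proof -
  obtain a b :: int where "z = Complex (of_int a) (of_int b)"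
    using assms by (auto simp: gauss_ints_def)
  then have "(cmod z)\<^sup>2 = real (nat (a\<^sup>2 + b\<^sup>2))"
    by (simp add: cmod_power2)
  then show ?thesis by (rule that)
qed

lemma gauss_ints_cmod_ge_1:
  assumes "z \<in> gauss_ints" "z \<noteq> 0"
  shows "cmod z \<ge> 1"
proof -
  obtain n :: nat where n: "(cmod z)\<^sup>2 = real n"
    using assms(1) by (rule gauss_ints_cmod_square)
  with assms(2) have "n \<noteq> 0" by (metis norm_eq_zero of_nat_0 power_eq_0_iff)
  then have "1\<^sup>2 \<le> (cmod z)\<^sup>2" unfolding n by simp
  then show ?thesis by (rule power2_le_imp_le) simp
qed

text \<open>The explicit set written out in \<open>gauss_coprime\<close>, named so that it can be
  folded there.\<close>

definition gauss_units :: "complex set" where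
  "gauss_units = {1, -1, \<i>, -\<i>}"

lemma card_gauss_units: "card gauss_units = 4"
  by (simp add: gauss_units_def complex_eq_iff)

lemma gauss_units_props:
  assumes "u \<in> gauss_units"
  shows "u \<in> gauss_ints" "u \<noteq> 0" "cmod u = 1" "inverse u \<in> gauss_units"
  using assms by (auto simp: gauss_units_def gauss_ints_iff)

lemma gauss_units_mult: "u \<in> gauss_units \<Longrightarrow> v \<in> gauss_units \<Longrightarrow> u * v \<in> gauss_units"
  by (auto simp: gauss_units_def)

lemma gauss_units_divide: "u \<in> gauss_units \<Longrightarrow> v \<in> gauss_units \<Longrightarrow> u / v \<in> gauss_units"
  by (simp add: divide_inverse gauss_units_mult gauss_units_props)

text \<open>In integers, \<open>a\<^sup>2 + b\<^sup>2 = 1\<close> forces one coordinate to be 0 and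
  the other to be 1 or -1.\<close>

lemma gauss_units_cmod_eq_1:
  assumes "z \<in> gauss_ints" "cmod z = 1"
  shows "z \<in> gauss_units"
proof -
  obtain a b :: int where z: "z = Complex (of_int a) (of_int b)"
    using assms(1) by (auto simp: gauss_ints_def)
  with assms(2) have "(of_int (a\<^sup>2 + b\<^sup>2) :: real) = 1"
    using cmod_power2[of z] by simp
  then have ab: "a\<^sup>2 + b\<^sup>2 = 1" by linarith
  have "x \<in> {-1, 0, 1}" if "x\<^sup>2 \<le> 1" for x :: int
    using that abs_square_le_1[of x] by auto
  from this[of a] this[of b] have "a \<in> {-1, 0, 1}" "b \<in> {-1, 0, 1}"
    using ab zero_le_power2[of a] zero_le_power2[of b] by linarith+
  with ab show ?thesis
    by (auto simp: z gauss_units_def complex_eq_iff)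
qed

text \<open>Both factors have absolute value at least 1 and these values multiply to 1, so each
  equals 1.\<close>

lemma gauss_units_mult_eq_1:
  assumes "z \<in> gauss_ints" "w \<in> gauss_ints" "z * w = 1"
  shows "z \<in> gauss_units"
proof (rule gauss_units_cmod_eq_1)
  have "z \<noteq> 0" "w \<noteq> 0" using assms(3) by auto
  then have "cmod z \<ge> 1" "cmod w \<ge> 1"
    using assms by (auto intro: gauss_ints_cmod_ge_1)
  moreover have "cmod z * cmod w = 1"
    using assms(3) by (metis norm_mult norm_one)
  ultimately show "cmod z = 1"
    by (smt (verit) mult_left_mono mult_cancel_left2)
qed (fact assms(1))

text \<open>The squared absolute value is a natural number other than 0 and 1. This is the source of
  the factor \<open>sqrt 2\<close> lost when a nonunit is cancelled.\<close>

lemma gauss_ints_nonunit_cmod: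
  assumes "z \<in> gauss_ints" "z \<noteq> 0" "z \<notin> gauss_units"
  shows "(cmod z)\<^sup>2 \<ge> 2"
proof -
  obtain n :: nat where n: "(cmod z)\<^sup>2 = real n"
    using assms(1) by (rule gauss_ints_cmod_square)
  have "n \<noteq> 0" using n assms(2) by (metis norm_eq_zero of_nat_0 power_eq_0_iff)
  moreover have "n \<noteq> 1"
    using n assms gauss_units_cmod_eq_1[of z] by (auto simp: power2_eq_1_iff) (smt (verit) norm_ge_zero)
  ultimately show ?thesis unfolding n by simp
qed

section \<open>Division with remainder and the ideal of denominators\<close>

lemma gauss_ints_round:
  obtains q where "q \<in> gauss_ints" "cmod (w - q) < 1"
proof
  let ?q = "Complex (of_int (round (Re w))) (of_int (round (Im w)))"
  show "?q \<in> gauss_ints" by (simp add: gauss_ints_iff)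
  have "\<bar>Re (w - ?q)\<bar> \<le> 1/2" "\<bar>Im (w - ?q)\<bar> \<le> 1/2"
    using of_int_round_abs_le[of "Re w"] of_int_round_abs_le[of "Im w"]
    by (simp_all add: abs_minus_commute)
  then have "(Re (w - ?q))\<^sup>2 \<le> (1/2)\<^sup>2" "(Im (w - ?q))\<^sup>2 \<le> (1/2)\<^sup>2"
    by (metis abs_ge_zero power2_abs power_mono)+
  then have "(cmod (w - ?q))\<^sup>2 < 1\<^sup>2"
    unfolding cmod_power2 by (simp add: power_divide)
  then show "cmod (w - ?q) < 1" by (rule power2_less_imp_less) simp
qed

text \<open>The denominators of \<open>z\<close> form an ideal; a nonzero element of least norm
  generates it by division with remainder.\<close>

lemma gauss_ints_least_denominator:
  assumes "b \<in> gauss_ints" "b \<noteq> 0" "z * b \<in> gauss_ints"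
  obtains c where "c \<in> gauss_ints" "c \<noteq> 0" "z * c \<in> gauss_ints"
    "\<And>d. d \<in> gauss_ints \<Longrightarrow> z * d \<in> gauss_ints \<Longrightarrow> \<exists>g\<in>gauss_ints. d = c * g"
proof -
  define P where "P c \<longleftrightarrow> c \<in> gauss_ints \<and> c \<noteq> 0 \<and> z * c \<in> gauss_ints" for c
  \<comment> \<open>A natural-valued norm permits a minimal choice; on Gaussian integers the floor
    loses nothing.\<close>
  define N where "N c = nat \<lfloor>(cmod c)\<^sup>2\<rfloor>" for c
  have N: "(cmod c)\<^sup>2 = real (N c)" if "c \<in> gauss_ints" for c
    using gauss_ints_cmod_square[OF that] by (metis N_def floor_of_nat nat_int)
  obtain c where c: "P c" and least: "\<And>d. P d \<Longrightarrow> N c \<le> N d"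
    using ex_has_least_nat[of P b N] assms by (auto simp: P_def)
  show ?thesis
  proof
    show "c \<in> gauss_ints" "c \<noteq> 0" "z * c \<in> gauss_ints" using c by (auto simp: P_def)
    fix d assume d: "d \<in> gauss_ints" "z * d \<in> gauss_ints"
    obtain q where q: "q \<in> gauss_ints" "cmod (d / c - q) < 1"
      by (rule gauss_ints_round)
    define r where "r = d - c * q"
    have "r = c * (d / c - q)" using \<open>c \<noteq> 0\<close> by (simp add: r_def field_simps)
    then have "cmod r = cmod c * cmod (d / c - q)" by (metis norm_mult)
    then have "cmod r < cmod c" using q(2) \<open>c \<noteq> 0\<close> by simp
    then have less: "(cmod r)\<^sup>2 < (cmod c)\<^sup>2" by (simp add: power_strict_mono)
    have r: "r \<in> gauss_ints"
      unfolding r_def using d q \<open>c \<in> gauss_ints\<close> by (intro gauss_ints_diff gauss_ints_mult)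
    have "z * r = z * d - z * c * q" by (simp add: r_def algebra_simps)
    then have "z * r \<in> gauss_ints"
      using d q \<open>z * c \<in> gauss_ints\<close> by (auto intro: gauss_ints_diff gauss_ints_mult)
    \<comment> \<open>The remainder is a denominator of smaller norm than \<open>c\<close>, which
      minimality allows only for 0.\<close>
    with r less least[of r] N[OF r] N[OF \<open>c \<in> gauss_ints\<close>] have "r = 0"
      by (auto simp: P_def)
    then show "\<exists>g\<in>gauss_ints. d = c * g" using q(1) by (auto simp: r_def)
  qed
qed

section \<open>The first quadrant\<close>

text \<open>Half-open: with the positive real axis but without the imaginary axis, so that its four
  rotations by units partition the nonzero plane.\<close>

definition quadrant :: "complex set" where
  "quadrant = {z. Re z > 0 \<and> Im z \<ge> 0}"

lemma quadrant_rotate: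
  assumes "z \<noteq> 0"
  obtains u where "u \<in> gauss_units" "u * z \<in> quadrant"
proof -
  have "Re z \<noteq> 0 \<or> Im z \<noteq> 0" using assms by (simp add: complex_eq_iff)
  then have "\<exists>u\<in>gauss_units. u * z \<in> quadrant"
    by (auto simp: gauss_units_def quadrant_def)
  then show ?thesis using that by blast
qed

lemma quadrant_unit_eq_1:
  assumes "z \<in> quadrant" "u * z \<in> quadrant" "u \<in> gauss_units"
  shows "u = 1"
  using assms by (auto simp: gauss_units_def quadrant_def)

text \<open>A coprime denominator generates the ideal of denominators, so \<open>b\<close> and
  \<open>b'\<close> are associates, and associates in the quadrant coincide. The numerators are then
  associates as well.\<close>

lemma coprime_quadrant_fractions_eq:
  assumes "a \<in> gauss_ints" "b \<in> gauss_ints" "a' \<in> gauss_ints" "b' \<in> gauss_ints"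
    and quad: "a \<in> quadrant" "b \<in> quadrant" "a' \<in> quadrant" "b' \<in> quadrant"
    and cop: "gauss_coprime a b" "gauss_coprime a' b'"
    and u: "u \<in> gauss_units" "u' \<in> gauss_units"
    and eq: "u * (a / b) = u' * (a' / b')"
  shows "u = u' \<and> a = a' \<and> b = b'"
proof -
  have nz: "a \<noteq> 0" "b \<noteq> 0" "a' \<noteq> 0" "b' \<noteq> 0" using quad by (auto simp: quadrant_def)
  note u_props = gauss_units_props[OF u(1)] gauss_units_props[OF u(2)]
  define z where "z = u * (a / b)"
  have zb: "z * b = u * a" using nz by (simp add: z_def)
  have zb': "z * b' = u' * a'" unfolding z_def eq using nz by simp
  obtain c where c: "c \<in> gauss_ints" "c \<noteq> 0" "z * c \<in> gauss_ints"
    and gen: "\<And>d. d \<in> gauss_ints \<Longrightarrow> z * d \<in> gauss_ints \<Longrightarrow> \<exists>g\<in>gauss_ints. d = c * g"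
    by (rule gauss_ints_least_denominator[of b z])
      (use assms nz u_props zb in \<open>auto intro: gauss_ints_mult\<close>)
  \<comment> \<open>Write \<open>y = c * g\<close>. As \<open>z * c\<close> is a Gaussian integer,
    \<open>g\<close> also divides \<open>x\<close>; coprimality makes \<open>g\<close> a
    unit.\<close>
  have unit: "\<exists>g\<in>gauss_units. y = c * g"
    if x: "x \<in> gauss_ints" and y: "y \<in> gauss_ints" and v: "v \<in> gauss_units"
      and zy: "z * y = v * x" and "gauss_coprime x y" for x y v
  proof -
    have "z * y \<in> gauss_ints"
      unfolding zy using gauss_units_props(1)[OF v] x by (rule gauss_ints_mult)
    then obtain g where g: "g \<in> gauss_ints" "y = c * g"
      using gen y by blast
    have "x = g * (inverse v * (z * c))"
      using zy gauss_units_props(2)[OF v] by (simp add: g field_simps)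
    moreover have "inverse v * (z * c) \<in> gauss_ints"
      using gauss_units_props(1)[OF gauss_units_props(4)[OF v]] c(3) by (rule gauss_ints_mult)
    ultimately have "gauss_dvd g x"
      unfolding gauss_dvd_def using g(1) by blast
    moreover have "gauss_dvd g y"
      using g c by (auto simp: gauss_dvd_def)
    ultimately show ?thesis
      using \<open>gauss_coprime x y\<close> g by (auto simp: gauss_coprime_def gauss_units_def)
  qed
  obtain g g' where g: "g \<in> gauss_units" "b = c * g" "g' \<in> gauss_units" "b' = c * g'"
    using unit[OF _ _ u(1) zb] unit[OF _ _ u(2) zb'] assms by blast
  have "b' = (g' / g) * b"
    using g gauss_units_props(2)[OF g(1)] by simp
  then have b: "b = b'"
    using quadrant_unit_eq_1[OF quad(2)] quad(4) g gauss_units_divide by fastforce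
  then have "a' = (u / u') * a"
    using eq nz u_props by (simp add: field_simps)
  moreover from this have "u / u' = 1"
    using quadrant_unit_eq_1[OF quad(1)] quad(3) u gauss_units_divide by fastforce
  ultimately show ?thesis using b u_props by simp
qed

section \<open>Singular fade states as fractions\<close>

text \<open>The subtraction is real, so the box is empty at \<open>m = 0\<close>, like the signal
  set itself.\<close>

definition gauss_box :: "nat \<Rightarrow> complex set" where
  "gauss_box m = {z \<in> gauss_ints. \<bar>Re z\<bar> \<le> real m - 1 \<and> \<bar>Im z\<bar> \<le> real m - 1}"

text \<open>A collision \<open>x + z * y = x' + z * y'\<close> says
  \<open>z * (y' - y) = x - x'\<close>; the scaling by one half cancels in the quotient.\<close>

lemma singular_fade_state_iff:
  assumes "finite S"
  shows "singular_fade_state S z \<longleftrightarrow>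
    (\<exists>d\<in>scaled_differences S. \<exists>d'\<in>scaled_differences S. d \<noteq> 0 \<and> d' \<noteq> 0 \<and> z = d / d')"
    (is "?L \<longleftrightarrow> ?R")
proof -
  define f where "f = (\<lambda>(x, y). x + z * y)"
  have "{x + z * y | x y. x \<in> S \<and> y \<in> S} = f ` (S \<times> S)"
    by (force simp: f_def)
  \<comment> \<open>On a finite set, losing image points is the same as failing to be
    injective.\<close>
  moreover have "card (f ` (S \<times> S)) < card (S \<times> S) \<longleftrightarrow> \<not> inj_on f (S \<times> S)"
    using assms by (metis card_image_le finite_cartesian_product inj_on_iff_eq_card le_neq_implies_less nat_neq_iff)
  ultimately have L: "?L \<longleftrightarrow> z \<noteq> 0 \<and> \<not> inj_on f (S \<times> S)"
    by (simp add: singular_fade_state_def fade_state_def card_cartesian_product power2_eq_square)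
  show ?thesis
  proof
    assume ?L
    then obtain x y x' y' where S: "x \<in> S" "y \<in> S" "x' \<in> S" "y' \<in> S"
      and z: "z \<noteq> 0" and eq: "x + z * y = x' + z * y'" and ne: "(x, y) \<noteq> (x', y')"
      unfolding L inj_on_def f_def by auto
    \<comment> \<open>Distinct colliding pairs differ in both coordinates: equal \<open>y\<close>
      would force equal \<open>x\<close>, and conversely since \<open>z\<close> is nonzero.\<close>
    have "y \<noteq> y'" using eq ne by auto
    then have "x \<noteq> x'" using eq z by auto
    have "z * (y' - y) = x - x'" using eq by algebra
    then have "z = (x - x') / (y' - y)"
      using \<open>y \<noteq> y'\<close> by (simp add: eq_divide_eq)
    moreover have "a / b = (a / 2) / (b / 2)" for a b :: complex by simp
    ultimately have "z = ((x - x') / 2) / ((y' - y) / 2)" by (rule trans)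
    moreover have "(x - x') / 2 \<in> scaled_differences S" "(y' - y) / 2 \<in> scaled_differences S"
      using S by (auto simp: scaled_differences_def)
    ultimately show ?R using \<open>x \<noteq> x'\<close> \<open>y \<noteq> y'\<close>
      by (metis divide_eq_0_iff eq_iff_diff_eq_0 zero_neq_numeral)
  next
    assume ?R
    then obtain d d' where d: "d \<in> scaled_differences S" "d' \<in> scaled_differences S"
      and nz: "d \<noteq> 0" "d' \<noteq> 0" and z: "z = d / d'" by blast
    obtain x x' y y' where S: "x \<in> S" "y \<in> S" "x' \<in> S" "y' \<in> S"
      and d_eq: "d = (x - x') / 2" "d' = (y - y') / 2"
      using d unfolding scaled_differences_def by blast
    have ne: "x \<noteq> x'" "y \<noteq> y'" using nz by (auto simp: d_eq)
    have "z \<noteq> 0" using nz z by simp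
    have diff: "y - y' = 2 * d'" "x - x' = 2 * d" by (simp_all add: d_eq)
    have "z * (y - y') = x - x'" unfolding diff using nz z by simp
    \<comment> \<open>The second coordinates are crossed so that both sides become sums.\<close>
    then have "x + z * y' = x' + z * y" by algebra
    then have "f (x, y') = f (x', y)" by (simp add: f_def)
    with \<open>z \<noteq> 0\<close> show ?L unfolding L inj_on_def using S ne by blast
  qed
qed

section \<open>The square of differences of the QAM set\<close>

lemma scaled_differences_qam: "scaled_differences (qam (m\<^sup>2)) = gauss_box m"
proof
  show "scaled_differences (qam (m\<^sup>2)) \<subseteq> gauss_box m"
  proof
    fix z assume "z \<in> scaled_differences (qam (m\<^sup>2))"
    then obtain p q r s where lt: "p < m" "q < m" "r < m" "s < m"
      and z: "z = (Complex (2 * real p - (real m - 1)) (2 * real q - (real m - 1)) -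
           Complex (2 * real r - (real m - 1)) (2 * real s - (real m - 1))) / 2"
      by (auto simp: scaled_differences_def qam_def pam_points_square)
    have "Re z = of_int (int p - int r)" "Im z = of_int (int q - int s)"
      by (simp_all add: z)
    then show "z \<in> gauss_box m"
      using lt by (auto simp: gauss_box_def gauss_ints_iff)
  qed
next
  have coord: "\<exists>x\<in>pam_points (m\<^sup>2). \<exists>y\<in>pam_points (m\<^sup>2). real_of_int a = (x - y) / 2"
    if "\<bar>real_of_int a\<bar> \<le> real m - 1" for a
  proof -
    \<comment> \<open>The positive and negative parts of \<open>a\<close> serve as indices of two
      points; their difference is \<open>a\<close>.\<close>
    have lt: "nat a < m" "nat (- a) < m" using that by linarith+
    have "real_of_int a = ((2 * real (nat a) - (real m - 1)) - (2 * real (nat (- a)) - (real m - 1))) / 2"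
      by simp
    with lt show ?thesis
      unfolding pam_points_square by blast
  qed
  show "gauss_box m \<subseteq> scaled_differences (qam (m\<^sup>2))"
  proof
    fix z assume "z \<in> gauss_box m"
    then obtain a b where z: "z = Complex (of_int a) (of_int b)"
      and "\<bar>real_of_int a\<bar> \<le> real m - 1" "\<bar>real_of_int b\<bar> \<le> real m - 1"
      by (auto simp: gauss_box_def gauss_ints_def)
    then obtain x x' y y' where P: "x \<in> pam_points (m\<^sup>2)" "x' \<in> pam_points (m\<^sup>2)"
        "y \<in> pam_points (m\<^sup>2)" "y' \<in> pam_points (m\<^sup>2)"
      and "real_of_int a = (x - x') / 2" "real_of_int b = (y - y') / 2"
      using coord by meson
    then have "z = (Complex x y - Complex x' y') / 2"
      by (simp add: z complex_eq_iff)
    then show "z \<in> scaled_differences (qam (m\<^sup>2))"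
      using P by (auto simp: scaled_differences_def qam_def)
  qed
qed

lemma delta_plus_qam_box: "delta_plus (qam (m\<^sup>2)) = gauss_box m \<inter> quadrant"
  by (auto simp: delta_plus_def scaled_differences_qam quadrant_def)

lemma finite_qam: "finite (qam (m\<^sup>2))"
proof -
  have "qam (m\<^sup>2) = (\<lambda>(a, b). Complex a b) ` (pam_points (m\<^sup>2) \<times> pam_points (m\<^sup>2))"
    by (auto simp: qam_def)
  then show ?thesis by (simp add: pam_points_square)
qed

lemma gauss_box_unit_mult:
  assumes "u \<in> gauss_units" "z \<in> gauss_box m"
  shows "u * z \<in> gauss_box m"
  using assms by (auto simp: gauss_units_def gauss_box_def gauss_ints_iff)

text \<open>A unit only rotates the square. Otherwise \<open>e * g\<close> has absolute value at
  most \<open>sqrt 2 * (m - 1)\<close>, the distance to a corner, so \<open>e\<close> has absolute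
  value at most \<open>m - 1\<close>.\<close>

lemma gauss_box_divisor:
  assumes "e * g \<in> gauss_box m" "e \<in> gauss_ints" "g \<in> gauss_ints" "g \<noteq> 0"
  shows "e \<in> gauss_box m"
proof (cases "g \<in> gauss_units")
  case True
  then have "inverse g * (e * g) \<in> gauss_box m"
    using assms(1) gauss_box_unit_mult gauss_units_props(4) by blast
  moreover have "inverse g * (e * g) = e" using \<open>g \<noteq> 0\<close> by simp
  ultimately show ?thesis by simp
next
  case False
  \<comment> \<open>The box is nonempty, hence its half-width is nonnegative and a square root may
    be taken below.\<close>
  have m: "0 \<le> real m - 1" using assms(1) by (auto simp: gauss_box_def)
  have "(cmod e)\<^sup>2 * 2 \<le> (cmod e)\<^sup>2 * (cmod g)\<^sup>2"
    using False assms by (intro mult_left_mono gauss_ints_nonunit_cmod) auto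
  also have "\<dots> = (cmod (e * g))\<^sup>2"
    by (simp add: norm_mult power_mult_distrib)
  also have "\<dots> = \<bar>Re (e * g)\<bar>\<^sup>2 + \<bar>Im (e * g)\<bar>\<^sup>2"
    by (simp only: cmod_power2 power2_abs)
  also have "\<dots> \<le> (real m - 1)\<^sup>2 + (real m - 1)\<^sup>2"
    using assms(1) unfolding gauss_box_def by (intro add_mono power_mono) auto
  finally have "(cmod e)\<^sup>2 \<le> (real m - 1)\<^sup>2" by simp
  then have "cmod e \<le> real m - 1" using m by (rule power2_le_imp_le)
  then show ?thesis
    using abs_Re_le_cmod[of e] abs_Im_le_cmod[of e] assms(2) by (auto simp: gauss_box_def)
qed

text \<open>The reduced fraction is \<open>z * c\<close> over \<open>c\<close>, with
  \<open>c\<close> a generator of the denominators. Both parts divide \<open>d\<close> and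
  \<open>d'\<close> with the same cofactor, hence stay in the box, and are then rotated.\<close>

lemma gauss_box_fraction_coprime:
  assumes "d \<in> gauss_box m" "d' \<in> gauss_box m" "d \<noteq> 0" "d' \<noteq> 0"
  obtains u a b where "u \<in> gauss_units" "a \<in> gauss_box m \<inter> quadrant" "b \<in> gauss_box m \<inter> quadrant"
    "gauss_coprime a b" "d / d' = u * (a / b)"
proof -
  define z where "z = d / d'"
  have ints: "d \<in> gauss_ints" "d' \<in> gauss_ints" using assms by (auto simp: gauss_box_def)
  have zd': "z * d' = d" using assms by (simp add: z_def)
  have "z \<noteq> 0" using assms by (simp add: z_def)
  obtain c where c: "c \<in> gauss_ints" "c \<noteq> 0" "z * c \<in> gauss_ints"
    and gen: "\<And>d. d \<in> gauss_ints \<Longrightarrow> z * d \<in> gauss_ints \<Longrightarrow> \<exists>g\<in>gauss_ints. d = c * g"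
    by (rule gauss_ints_least_denominator[of d' z]) (use ints assms zd' in auto)
  obtain g where g: "g \<in> gauss_ints" "d' = c * g"
    using gen ints zd' by blast
  have "g \<noteq> 0" using g assms by auto
  have "c \<in> gauss_box m" "z * c \<in> gauss_box m"
    using gauss_box_divisor[OF _ c(1) g(1) \<open>g \<noteq> 0\<close>] gauss_box_divisor[OF _ c(3) g(1) \<open>g \<noteq> 0\<close>]
      assms zd' g by (auto simp: mult.assoc)
  obtain v where v: "v \<in> gauss_units" "v * (z * c) \<in> quadrant"
    using quadrant_rotate[of "z * c"] \<open>z \<noteq> 0\<close> c by auto
  obtain w where w: "w \<in> gauss_units" "w * c \<in> quadrant"
    using quadrant_rotate[of c] c by auto
  note unit_props = gauss_units_props[OF v(1)] gauss_units_props[OF w(1)]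
  show ?thesis
  proof
    \<comment> \<open>This unit undoes the rotations \<open>v\<close> of the numerator and
      \<open>w\<close> of the denominator.\<close>
    show "w / v \<in> gauss_units" using v w by (intro gauss_units_divide)
    show "v * (z * c) \<in> gauss_box m \<inter> quadrant" "w * c \<in> gauss_box m \<inter> quadrant"
      using v w \<open>c \<in> gauss_box m\<close> \<open>z * c \<in> gauss_box m\<close> by (auto intro: gauss_box_unit_mult)
    show "d / d' = w / v * (v * (z * c) / (w * c))"
      using c unit_props by (simp add: z_def)
    show "gauss_coprime (v * (z * c)) (w * c)"
      unfolding gauss_coprime_def gauss_units_def[symmetric]
    proof (intro allI impI, elim conjE)
      fix \<delta> assume "gauss_dvd \<delta> (v * (z * c))" "gauss_dvd \<delta> (w * c)"
      then obtain x y where xy: "x \<in> gauss_ints" "y \<in> gauss_ints" "\<delta> \<in> gauss_ints"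
        and x: "v * (z * c) = \<delta> * x" and y: "w * c = \<delta> * y"
        by (auto simp: gauss_dvd_def)
      have c_eq: "c = \<delta> * (inverse w * y)" and zc_eq: "z * c = \<delta> * (inverse v * x)"
        using x y unit_props by (simp_all add: field_simps)
      have "\<delta> \<noteq> 0" using c_eq c by auto
      \<comment> \<open>Cancelling \<delta> leaves another denominator, which must be a multiple of
        \<open>c\<close>. As \<open>c\<close> is in turn \<delta> times it, \<delta> is a
        unit.\<close>
      have "z * (inverse w * y) = inverse v * x"
        using \<open>\<delta> \<noteq> 0\<close> zc_eq unfolding c_eq by simp
      then have "z * (inverse w * y) \<in> gauss_ints"
        using xy v by (simp add: gauss_ints_mult gauss_units_props)
      moreover have "inverse w * y \<in> gauss_ints"
        using xy w by (simp add: gauss_ints_mult gauss_units_props)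
      ultimately obtain k where k: "k \<in> gauss_ints" "inverse w * y = c * k"
        using gen by blast
      have "c * (\<delta> * k) = c * 1" using c_eq k by (simp add: mult_ac)
      then have "\<delta> * k = 1" using c by (simp only: mult_cancel_left) simp
      then show "\<delta> \<in> gauss_units"
        using xy k by (intro gauss_units_mult_eq_1)
    qed
  qed
qed

section \<open>Counting\<close>

lemma gauss_coprime_commute: "gauss_coprime a b \<longleftrightarrow> gauss_coprime b a"
  by (auto simp: gauss_coprime_def)

text \<open>The element is a common divisor of itself with itself; conversely, every divisor of a
  unit is a unit.\<close>

lemma gauss_coprime_self_iff:
  assumes "a \<in> gauss_ints"
  shows "gauss_coprime a a \<longleftrightarrow> a \<in> gauss_units"
proof
  assume "gauss_coprime a a"
  moreover have "gauss_dvd a a"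
    using assms by (auto simp: gauss_dvd_def gauss_ints_iff intro!: bexI[of _ 1])
  ultimately show "a \<in> gauss_units"
    by (auto simp: gauss_coprime_def gauss_units_def)
next
  assume a: "a \<in> gauss_units"
  show "gauss_coprime a a"
    unfolding gauss_coprime_def gauss_units_def[symmetric]
  proof (intro allI impI, elim conjE)
    fix \<delta> assume "gauss_dvd \<delta> a"
    then obtain g where g: "\<delta> \<in> gauss_ints" "g \<in> gauss_ints" "a = \<delta> * g"
      by (auto simp: gauss_dvd_def)
    then have "\<delta> * (g * inverse a) = 1"
      using gauss_units_props(2)[OF a] by (metis mult.assoc right_inverse)
    then show "\<delta> \<in> gauss_units"
      using g a by (blast intro: gauss_units_mult_eq_1 gauss_ints_mult gauss_units_props)
  qed
qed

text \<open>Forgetting the order is a two-to-one map: the fibre over \<open>{a, b}\<close> is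
  \<open>(a, b)\<close> and \<open>(b, a)\<close>.\<close>

lemma card_symmetric_pairs:
  assumes "finite A" and sym: "\<And>a b. R a b \<Longrightarrow> R b a"
  shows "card {(a, b). a \<in> A \<and> b \<in> A \<and> a \<noteq> b \<and> R a b} =
    2 * card {{a, b} | a b. a \<in> A \<and> b \<in> A \<and> a \<noteq> b \<and> R a b}"
proof -
  define C where "C = {(a, b). a \<in> A \<and> b \<in> A \<and> a \<noteq> b \<and> R a b}"
  define f :: "'a \<times> 'a \<Rightarrow> 'a set" where "f = (\<lambda>(a, b). {a, b})"
  have "C \<subseteq> A \<times> A" by (auto simp: C_def)
  then have fin: "finite C" using assms(1) finite_subset by blast
  have fibre: "card {p \<in> C. f p = e} = 2" if e: "e \<in> f ` C" for e
  proof -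
    obtain a b where ab: "(a, b) \<in> C" "e = {a, b}" using e by (auto simp: f_def)
    then have "{p \<in> C. f p = e} = {(a, b), (b, a)}"
      using sym by (auto simp: C_def f_def doubleton_eq_iff)
    then show ?thesis using ab by (auto simp: C_def)
  qed
  have "card C = (\<Sum>e\<in>f ` C. card {p \<in> C. f p = e})"
    using sum.image_gen[OF fin, of "\<lambda>_. 1 :: nat" f] by simp
  also have "\<dots> = 2 * card (f ` C)" using fibre by simp
  also have "f ` C = {{a, b} | a b. a \<in> A \<and> b \<in> A \<and> a \<noteq> b \<and> R a b}"
    by (force simp: f_def C_def)
  finally show ?thesis by (simp add: C_def)
qed

lemma card_coprime_pairs:
  assumes "finite A" "A \<subseteq> gauss_ints \<inter> quadrant" "1 \<in> A"
  shows "card {(a, b). a \<in> A \<and> b \<in> A \<and> gauss_coprime a b} = 1 + 2 * num_coprime_pairs A"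
proof -
  let ?C = "{(a, b). a \<in> A \<and> b \<in> A \<and> a \<noteq> b \<and> gauss_coprime a b}"
  \<comment> \<open>A diagonal entry is a unit, and 1 is the only unit in the quadrant.\<close>
  have "a = 1" if "a \<in> A" "gauss_coprime a a" for a
    using that assms quadrant_unit_eq_1[of 1 a] gauss_coprime_self_iff[of a] by auto
  moreover have "gauss_coprime 1 1"
    by (subst gauss_coprime_self_iff) (auto simp: gauss_ints_iff gauss_units_def)
  ultimately have "{(a, b). a \<in> A \<and> b \<in> A \<and> gauss_coprime a b} = insert (1, 1) ?C"
    using assms(3) by auto
  moreover have "finite ?C"
    by (rule finite_subset[of _ "A \<times> A"]) (use assms(1) in auto)
  moreover have "card ?C = 2 * num_coprime_pairs A"
    unfolding num_coprime_pairs_def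
    by (rule card_symmetric_pairs[OF assms(1)]) (simp add: gauss_coprime_commute)
  ultimately show ?thesis by simp
qed

text \<open>Four units times \<open>1 + 2 * num_coprime_pairs A\<close> ordered coprime pairs give
  the count.\<close>

lemma card_singular_fade_states_qam:
  assumes "m \<ge> 2"
  shows "card {z. singular_fade_state (qam (m\<^sup>2)) z} =
    4 + 8 * num_coprime_pairs (delta_plus (qam (m\<^sup>2)))"
proof -
  define A where "A = delta_plus (qam (m\<^sup>2))"
  have A: "A = gauss_box m \<inter> quadrant" unfolding A_def by (rule delta_plus_qam_box)
  have A_sub: "A \<subseteq> gauss_ints \<inter> quadrant" by (auto simp: A gauss_box_def)
  define C where "C = {(a, b). a \<in> A \<and> b \<in> A \<and> gauss_coprime a b}"
  define h :: "complex \<times> complex \<times> complex \<Rightarrow> complex" where "h = (\<lambda>(u, a, b). u * (a / b))"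
  have "finite (scaled_differences (qam (m\<^sup>2)))"
    unfolding scaled_differences_def by (rule finite_image_set2) (simp_all add: finite_qam)
  then have "finite A" by (auto simp: A_def delta_plus_def)
  \<comment> \<open>Here \<open>m \<ge> 2\<close> enters: for \<open>m = 1\<close> the box is just
    0.\<close>
  have "1 \<in> A" using assms by (simp add: A gauss_box_def gauss_ints_iff quadrant_def)
  have "inj_on h (gauss_units \<times> C)"
  proof (rule inj_onI, clarsimp simp: h_def C_def)
    fix u a b u' a' b'
    assume "u \<in> gauss_units" "u' \<in> gauss_units" "a \<in> A" "b \<in> A" "a' \<in> A" "b' \<in> A"
      "gauss_coprime a b" "gauss_coprime a' b'" "u * a / b = u' * a' / b'"
    then show "u = u' \<and> a = a' \<and> b = b'"
      using A_sub by (intro coprime_quadrant_fractions_eq) auto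
  qed
  then have "card (h ` (gauss_units \<times> C)) = card gauss_units * card C"
    by (simp add: card_image card_cartesian_product)
  moreover have "h ` (gauss_units \<times> C) = {z. singular_fade_state (qam (m\<^sup>2)) z}"
  proof (intro equalityI subsetI)
    fix z assume "z \<in> h ` (gauss_units \<times> C)"
    then obtain u a b where u: "u \<in> gauss_units" and ab: "a \<in> A" "b \<in> A" and z: "z = (u * a) / b"
      by (auto simp: h_def C_def)
    \<comment> \<open>Absorbing the unit into the numerator exhibits \<open>z\<close> as a quotient
      of nonzero differences.\<close>
    have "u * a \<in> gauss_box m" "b \<in> gauss_box m" "u * a \<noteq> 0" "b \<noteq> 0"
      using u ab gauss_units_props(2)[OF u] by (auto simp: A quadrant_def intro: gauss_box_unit_mult)
    then show "z \<in> {z. singular_fade_state (qam (m\<^sup>2)) z}"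
      unfolding mem_Collect_eq singular_fade_state_iff[OF finite_qam] scaled_differences_qam
      using z by blast
  next
    fix z assume "z \<in> {z. singular_fade_state (qam (m\<^sup>2)) z}"
    then obtain d d' where d: "d \<in> gauss_box m" "d' \<in> gauss_box m" "d \<noteq> 0" "d' \<noteq> 0"
      and z: "z = d / d'"
      unfolding mem_Collect_eq singular_fade_state_iff[OF finite_qam] scaled_differences_qam
      by blast
    obtain u a b where "u \<in> gauss_units" "a \<in> A" "b \<in> A" "gauss_coprime a b" "z = h (u, a, b)"
      using gauss_box_fraction_coprime[OF d] by (auto simp: A z h_def)
    then show "z \<in> h ` (gauss_units \<times> C)" by (auto simp: C_def)
  qed
  moreover have "card C = 1 + 2 * num_coprime_pairs A"
    unfolding C_def using \<open>finite A\<close> A_sub \<open>1 \<in> A\<close> by (rule card_coprime_pairs)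
  ultimately show ?thesis by (simp add: card_gauss_units A_def)
qed

theorem lemma3:
  fixes M l :: nat
  assumes "l \<ge> 1" and "M = 2 ^ (2 * l)"
  shows "card {z. singular_fade_state (qam M) z} = 4 + 8 * num_coprime_pairs (delta_plus (qam M))"
proof -
  have "M = (2 ^ l)\<^sup>2" using assms(2) by (simp add: power_mult mult.commute)
  moreover have "2 ^ 1 \<le> (2 :: nat) ^ l" using assms(1) by (intro power_increasing) auto
  ultimately show ?thesis using card_singular_fade_states_qam[of "2 ^ l"] by simp
qed

end
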